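(* Let $\tau>0$ and $\mathbf{X}^0\in[V^h]^2$. Let $\mathbf{X}^1\in[V^h]^2$ be obtained from $\mathbf{X}^0$ by one step of the PD-Euler scheme with time step $\tau$ (see context), and for each $m\ge1$ let $(\mathbf{X}^{m+1},\kappa^{m+1},\lambda^{m+1})\in[V^h]^2\times V^h\times\mathbb{R}$ be a solution of the PD-BDF2 scheme: for all $(\varphi^h,\boldsymbol{\omega}^h)\in V^h\times[V^h]^2$, writing $\widetilde\Gamma=\widetilde\Gamma^{m+1}$ and $\widetilde{\mathbf{n}}=\widetilde{\mathbf{n}}^{m+1}$, \begin{align*} \left(\tfrac{\frac32\mathbf{X}^{m+1}-2\mathbf{X}^m+\frac12\mathbf{X}^{m-1}}{\tau},\varphi^h\widetilde{\mathbf{n}}\right)^h_{\widetilde\Gamma}+\left(\partial_s\kappa^{m+1},\partial_s\varphi^h\right)_{\widetilde\Gamma}-\lambda^{m+1}\left(\kappa^{m+1},\varphi^h\right)^h_{\widetilde\Gamma}&=0,\\ \left(\kappa^{m+1}\widetilde{\mathbf{n}},\boldsymbol{\omega}^h\right)^h_{\widetilde\Gamma}-\left(\partial_s\mathbf{X}^{m+1},\partial_s\boldsymbol{\omega}^h\right)_{\widetilde\Gamma}&=0,\\ \tfrac{\frac32L^{m+1}-2L^m+\frac12L^{m-1}}{\tau}+\left(\partial_s\kappa^{m+1},\partial_s\kappa^{m+1}\right)_{\widetilde\Gamma}&=0, \end{align*} where $L^m=L(\mathbf{X}^m)$ and $\widetilde\Gamma^{m+1}=\widetilde{\mathbf{X}}^{m+1}(\mathbb{I})$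 is the predicted polygon, with normal $\widetilde{\mathbf{n}}^{m+1}$, obtained by one step of the PD-Euler scheme with time step $\tau$ starting from $\mathbf{X}^m$. Then for all $m\ge0$, $$L^{m+1}\le L^m\le\dots\le L^0 .$$
   Context: Let $\mathbb{I}=[0,1]=\bigcup_{j=1}^N I_j$, $N\ge3$, $I_j=[\rho_{j-1},\rho_j]$, $0=\rho_0<\dots<\rho_N=1$, and $$V^h=\{u\in C(\mathbb{I}):u|_{I_j}\text{ is linear for all }j=1,\dots,N,\ u(\rho_0)=u(\rho_N)\}.$$ For $\mathbf{X}\in[V^h]^2$ with polygon $\Gamma=\mathbf{X}(\mathbb{I})$ set $\mathbf{h}_j=\mathbf{X}(\rho_j)-\mathbf{X}(\rho_{j-1})$ (assumed nonzero for all $j$). On $\Gamma$ the piecewise constant normal and the tangential derivative are $\mathbf{n}|_{I_j}=-\mathbf{h}_j^\perp/|\mathbf{h}_j|$ and $\partial_sf|_{I_j}=\partial_\rho f/|\partial_\rho\mathbf{X}|$, where $(\cdot)^\perp$ is clockwise rotation by $\pi/2$, $(a,b)^\perp=(b,-a)$. The inner products are $(u,v)_\Gamma=\int_{\mathbb{I}}u\cdot v\,|\partial_\rho\mathbf{X}|\,\mathrm{d}\rho$ and the mass-lumped one $$(u,v)^h_\Gamma=\frac12\sum_{j=1}^N|\mathbf{h}_j|\left[(u\cdot v)(\rho_j^-)+(u\cdot v)(\rho_{j-1}^+)\right]$$ for piecewise continuous scalar/vector functions with one-sided limits $u(\rho_j^\pm)$. Within an inner product on a polygon, $\partial_s$ is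 the tangential derivative of that polygon. The perimeter is $L(\mathbf{X})=\int_{\mathbb{I}}|\partial_\rho\mathbf{X}|\,\mathrm{d}\rho$. One step of the PD-Euler scheme with time step $\sigma>0$ from $\mathbf{X}\in[V^h]^2$ (polygon $\Gamma$, normal $\mathbf{n}$) produces $\mathbf{Y}\in[V^h]^2$ if there are $k\in V^h$ and $\ell\in\mathbb{R}$ such that for all $\varphi^h\in V^h$, $\boldsymbol{\omega}^h\in[V^h]^2$: \begin{align*} &\left(\tfrac{\mathbf{Y}-\mathbf{X}}{\sigma},\varphi^h\mathbf{n}\right)^h_\Gamma+(\partial_sk,\partial_s\varphi^h)_\Gamma-\ell\,(k,\varphi^h)^h_\Gamma=0,\\ &(k\,\mathbf{n},\boldsymbol{\omega}^h)^h_\Gamma-(\partial_s\mathbf{Y},\partial_s\boldsymbol{\omega}^h)_\Gamma=0,\\ &\tfrac{L(\mathbf{Y})-L(\mathbf{X})}{\sigma}+(\partial_sk,\partial_sk)_\Gamma=0. \end{align*} *)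

theory Defs
  imports "HOL-Analysis.Analysis"
begin

text \<open>
  A mesh is a number \<open>N\<close> of cells together with nodes \<open>r 0 < \<dots> < r N\<close>; only
  \<open>r j\<close> with \<open>j \<le> N\<close> matter. Functions on \<open>[0,1]\<close> are total functions on
  \<open>real\<close>; every notion below depends on their values on \<open>[0,1]\<close> only.
\<close>

definition cell :: "(nat \<Rightarrow> real) \<Rightarrow> nat \<Rightarrow> real set" where
  "cell r j = {r (j - 1)..r j}"

definition Vh :: "nat \<Rightarrow> (nat \<Rightarrow> real) \<Rightarrow> (real \<Rightarrow> real) set" where
  "Vh N r = {u. continuous_on {0..1} u \<and>
     (\<forall>j\<in>{1..N}. \<exists>a b. \<forall>x\<in>cell r j. u x = a + b * x) \<and> u (r 0) = u (r N)}"

definition Vh2 :: "nat \<Rightarrow> (nat \<Rightarrow> real) \<Rightarrow> (real \<Rightarrow> real^2) set" where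
  "Vh2 N r = {X. \<forall>i. (\<lambda>x. X x $ i) \<in> Vh N r}"

definition edge :: "(nat \<Rightarrow> real) \<Rightarrow> (real \<Rightarrow> real^2) \<Rightarrow> nat \<Rightarrow> real^2" where
  "edge r X j = X (r j) - X (r (j - 1))"

definition nondegenerate :: "nat \<Rightarrow> (nat \<Rightarrow> real) \<Rightarrow> (real \<Rightarrow> real^2) \<Rightarrow> bool" where
  "nondegenerate N r X \<longleftrightarrow> (\<forall>j\<in>{1..N}. edge r X j \<noteq> 0)"

definition perp :: "real^2 \<Rightarrow> real^2" where
  "perp v = vector [v $ 2, - (v $ 1)]"

text \<open>
  The normal is double-valued at the nodes; there we take the value of the left cell
  (of the first cell at \<open>0\<close>). The choice is immaterial, since the normal is only used
  through its one-sided limits.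
\<close>

definition normal :: "(nat \<Rightarrow> real) \<Rightarrow> (real \<Rightarrow> real^2) \<Rightarrow> real \<Rightarrow> real^2" where
  "normal r X x =
     (let j = (LEAST j. 1 \<le> j \<and> x \<in> cell r j)
      in - (perp (edge r X j) /\<^sub>R norm (edge r X j)))"

text \<open>
  For piecewise linear \<open>f\<close> the derivative is unspecified at the nodes where \<open>f\<close> has a
  kink; these form a null set and derivatives occur only under integrals.
\<close>

definition d_rho :: "(real \<Rightarrow> 'a::real_normed_vector) \<Rightarrow> real \<Rightarrow> 'a" where
  "d_rho f x = vector_derivative f (at x within {0..1})"

definition d_s :: "(real \<Rightarrow> real^2) \<Rightarrow> (real \<Rightarrow> 'a::real_normed_vector) \<Rightarrow> real \<Rightarrow> 'a" where
  "d_s X f x = d_rho f x /\<^sub>R norm (d_rho X x)"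

definition ip :: "(real \<Rightarrow> real^2) \<Rightarrow> (real \<Rightarrow> 'a::real_inner) \<Rightarrow> (real \<Rightarrow> 'a) \<Rightarrow> real" where
  "ip X u v = integral {0..1} (\<lambda>x. (u x \<bullet> v x) * norm (d_rho X x))"

definition ip_lumped ::
  "nat \<Rightarrow> (nat \<Rightarrow> real) \<Rightarrow> (real \<Rightarrow> real^2) \<Rightarrow>
     (real \<Rightarrow> 'a::real_inner) \<Rightarrow> (real \<Rightarrow> 'a) \<Rightarrow> real" where
  "ip_lumped N r X u v =
     1/2 * (\<Sum>j=1..N. norm (edge r X j) *
       (Lim (at_left (r j)) (\<lambda>x. u x \<bullet> v x) +
        Lim (at_right (r (j - 1))) (\<lambda>x. u x \<bullet> v x)))"

definition perimeter :: "(real \<Rightarrow> real^2) \<Rightarrow> real" where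
  "perimeter X = integral {0..1} (\<lambda>x. norm (d_rho X x))"

definition pd_euler_step ::
  "nat \<Rightarrow> (nat \<Rightarrow> real) \<Rightarrow> real \<Rightarrow> (real \<Rightarrow> real^2) \<Rightarrow> (real \<Rightarrow> real^2) \<Rightarrow> bool" where
  "pd_euler_step N r \<sigma> X Y \<longleftrightarrow>
     (\<exists>k\<in>Vh N r. \<exists>l::real.
        (\<forall>\<phi>\<in>Vh N r. \<forall>\<omega>\<in>Vh2 N r.
           ip_lumped N r X (\<lambda>x. (Y x - X x) /\<^sub>R \<sigma>) (\<lambda>x. \<phi> x *\<^sub>R normal r X x)
             + ip X (d_s X k) (d_s X \<phi>) - l * ip_lumped N r X k \<phi> = 0 \<and>
           ip_lumped N r X (\<lambda>x. k x *\<^sub>R normal r X x) \<omega>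
             - ip X (d_s X Y) (d_s X \<omega>) = 0) \<and>
        (perimeter Y - perimeter X) / \<sigma> + ip X (d_s X k) (d_s X k) = 0)"

text \<open>
  Below, \<open>Z\<close> is the predicted polygon, \<open>X0\<close>, \<open>X1\<close> are the two previous iterates, and
  \<open>(Y, \<kappa>, l)\<close> is the new solution.
\<close>

definition pd_bdf2_step ::
  "nat \<Rightarrow> (nat \<Rightarrow> real) \<Rightarrow> real \<Rightarrow> (real \<Rightarrow> real^2) \<Rightarrow> (real \<Rightarrow> real^2) \<Rightarrow> (real \<Rightarrow> real^2) \<Rightarrow>
     (real \<Rightarrow> real^2) \<Rightarrow> (real \<Rightarrow> real) \<Rightarrow> real \<Rightarrow> bool" where
  "pd_bdf2_step N r \<tau> Z X0 X1 Y \<kappa> l \<longleftrightarrow>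
     (\<forall>\<phi>\<in>Vh N r. \<forall>\<omega>\<in>Vh2 N r.
        ip_lumped N r Z
            (\<lambda>x. ((3/2) *\<^sub>R Y x - 2 *\<^sub>R X1 x + (1/2) *\<^sub>R X0 x) /\<^sub>R \<tau>)
            (\<lambda>x. \<phi> x *\<^sub>R normal r Z x)
          + ip Z (d_s Z \<kappa>) (d_s Z \<phi>) - l * ip_lumped N r Z \<kappa> \<phi> = 0 \<and>
        ip_lumped N r Z (\<lambda>x. \<kappa> x *\<^sub>R normal r Z x) \<omega>
          - ip Z (d_s Z Y) (d_s Z \<omega>) = 0) \<and>
     (3/2 * perimeter Y - 2 * perimeter X1 + 1/2 * perimeter X0) / \<tau>
       + ip Z (d_s Z \<kappa>) (d_s Z \<kappa>) = 0"

end

theory Submission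
  imports Defs
begin

text \<open>
  Only the third equation of each step matters. The dissipation term
  \<open>(\<partial>\<^sub>s \<kappa>, \<partial>\<^sub>s \<kappa>)\<close> is nonnegative, so an Euler step does not increase the perimeter, and a
  BDF2 step gives \<open>3/2 (L\<^sub>m\<^sub>+\<^sub>1 - L\<^sub>m) \<le> 1/2 (L\<^sub>m - L\<^sub>m\<^sub>-\<^sub>1)\<close>, so monotonicity
  propagates by induction.
\<close>

text \<open>No integrability is required: the integral of a non-integrable function is \<open>0\<close>.\<close>

lemma ip_self_nonneg: "0 \<le> ip X u u"
  unfolding ip_def
  by (cases "(\<lambda>x. (u x \<bullet> u x) * norm (d_rho X x)) integrable_on {0..1}")
    (auto intro!: integral_nonneg simp: not_integrable_integral)

lemma pd_euler_step_perimeter_le: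
  assumes "pd_euler_step N r \<sigma> X Y" and "0 < \<sigma>"
  shows "perimeter Y \<le> perimeter X"
proof -
  \<comment> \<open>The type annotation is needed to pin \<open>k\<close> down as scalar, since
    \<open>d_s\<close> and \<open>ip\<close> are polymorphic.\<close>
  obtain k :: "real \<Rightarrow> real" where "(perimeter Y - perimeter X) / \<sigma> + ip X (d_s X k) (d_s X k) = 0"
    using assms(1) unfolding pd_euler_step_def by blast
  then have "(perimeter Y - perimeter X) / \<sigma> \<le> 0"
    using ip_self_nonneg[of X "d_s X k"] by linarith
  then show ?thesis
    using assms(2) by (simp add: divide_le_0_iff)
qed

lemma pd_bdf2_step_perimeter_le:
  assumes "pd_bdf2_step N r \<tau> Z X0 X1 Y \<kappa> l" and "0 < \<tau>"
    and "perimeter X1 \<le> perimeter X0"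
  shows "perimeter Y \<le> perimeter X1"
proof -
  have "(3/2 * perimeter Y - 2 * perimeter X1 + 1/2 * perimeter X0) / \<tau>
      + ip Z (d_s Z \<kappa>) (d_s Z \<kappa>) = 0"
    using assms(1) unfolding pd_bdf2_step_def by blast
  then have "(3/2 * perimeter Y - 2 * perimeter X1 + 1/2 * perimeter X0) / \<tau> \<le> 0"
    using ip_self_nonneg[of Z "d_s Z \<kappa>"] by linarith
  then have "3/2 * perimeter Y - 2 * perimeter X1 + 1/2 * perimeter X0 \<le> 0"
    using assms(2) by (simp only: divide_le_0_iff) linarith
  \<comment> \<open>With a, b, c the perimeters of \<open>Y\<close>, \<open>X1\<close>,
    \<open>X0\<close>, the left side is 3/2 (a - b) - 1/2 (b - c), and b - c is at most 0.\<close>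
  then show ?thesis
    using assms(3) by linarith
qed

theorem theorem4p1:
  fixes N :: nat and r :: "nat \<Rightarrow> real" and \<tau> :: real
    and X Xt :: "nat \<Rightarrow> real \<Rightarrow> real^2"
    and \<kappa> :: "nat \<Rightarrow> real \<Rightarrow> real" and l :: "nat \<Rightarrow> real"
  assumes "3 \<le> N" and "r 0 = 0" and "r N = 1" and "\<forall>j<N. r j < r (Suc j)"
    and "0 < \<tau>"
    and "\<forall>m. X m \<in> Vh2 N r \<and> nondegenerate N r (X m)"
    and "pd_euler_step N r \<tau> (X 0) (X 1)"
    and "\<forall>m\<ge>1. Xt (m + 1) \<in> Vh2 N r \<and> nondegenerate N r (Xt (m + 1)) \<and>
           pd_euler_step N r \<tau> (X m) (Xt (m + 1))"
    and "\<forall>m\<ge>1. \<kappa> (m + 1) \<in> Vh N r \<and>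
           pd_bdf2_step N r \<tau> (Xt (m + 1)) (X (m - 1)) (X m) (X (m + 1))
             (\<kappa> (m + 1)) (l (m + 1))"
  shows "\<forall>m. \<forall>i\<le>m. perimeter (X (i + 1)) \<le> perimeter (X i)"
proof -
  have "perimeter (X (i + 1)) \<le> perimeter (X i)" for i
  proof (induction i)
    case 0
    show ?case
      using pd_euler_step_perimeter_le[OF assms(7,5)] by simp
  next
    case (Suc i)
    \<comment> \<open>The scheme is taken at m = \<open>Suc i\<close>, so m is at least 1 and the
      truncated \<open>m - 1\<close> is exactly \<open>i\<close>.\<close>
    have "pd_bdf2_step N r \<tau> (Xt (Suc i + 1)) (X i) (X (i + 1)) (X (Suc i + 1))
        (\<kappa> (Suc i + 1)) (l (Suc i + 1))"
      using assms(9)[rule_format, of "Suc i"] by simp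
    from pd_bdf2_step_perimeter_le[OF this assms(5) Suc.IH] show ?case
      by simp
  qed
  then show ?thesis
    by blast
qed

end
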